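(* Let $m\ge 2$ and let $n=4k+1\ge 5$ with $k$ an integer. Then $\chi_{lat}(mK_n)\le \min\{n+3,\; n-1+m\}$.
   Context: All graphs are finite and simple. For a graph $G$ with $p$ vertices and $q$ edges, a local antimagic total labeling of $G$ is a bijection $f:V(G)\cup E(G)\to\{1,2,\ldots,p+q\}$ such that $w_f(u)\neq w_f(v)$ for every edge $uv\in E(G)$, where $w_f(u)=f(u)+\sum_{uv\in E(G)}f(uv)$ is the weight of $u$ (the sum is over all edges incident to $u$). The local antimagic total chromatic number $\chi_{lat}(G)$ is the minimum, over all local antimagic total labelings $f$ of $G$, of the number of distinct values of $w_f$ on $V(G)$. (It is known that every graph has a local antimagic total labeling.) $mK_n$ denotes the disjoint union of $m$ copies of the complete graph $K_n$. *)

theory Defs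
  imports Main
begin

text \<open>
  An undirected graph is given by its vertex set and its edge set, an edge being the two-element
  set of its endpoints.
\<close>

record 'a graph =
  verts :: "'a set"
  edges :: "'a set set"

definition finite_simple_graph :: "'a graph \<Rightarrow> bool" where
  "finite_simple_graph G \<longleftrightarrow>
     finite (verts G) \<and> (\<forall>e\<in>edges G. e \<subseteq> verts G \<and> card e = 2)"

text \<open>
  A total labeling is a function on the disjoint sum \<open>verts G <+> edges G\<close>: a vertex \<open>u\<close> has label
  \<open>f (Inl u)\<close> and an edge \<open>e\<close> has label \<open>f (Inr e)\<close>.
\<close>

definition weight :: "'a graph \<Rightarrow> ('a + 'a set \<Rightarrow> nat) \<Rightarrow> 'a \<Rightarrow> nat" where
  "weight G f u = f (Inl u) + (\<Sum>e\<in>{e \<in> edges G. u \<in> e}. f (Inr e))"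

definition local_antimagic_total_labeling :: "'a graph \<Rightarrow> ('a + 'a set \<Rightarrow> nat) \<Rightarrow> bool" where
  "local_antimagic_total_labeling G f \<longleftrightarrow>
     bij_betw f (verts G <+> edges G) {1..card (verts G) + card (edges G)} \<and>
     (\<forall>u v. {u, v} \<in> edges G \<longrightarrow> weight G f u \<noteq> weight G f v)"

text \<open>
  The minimum ranges over a nonempty set, as every finite simple graph has a local antimagic total
  labeling.  (\<open>LEAST\<close> is unspecified on an empty set, whereas \<open>Inf\<close> on \<open>nat\<close> would be \<open>0\<close>
  there.)
\<close>

definition chi_lat :: "'a graph \<Rightarrow> nat" where
  "chi_lat G =
     (LEAST c. \<exists>f. local_antimagic_total_labeling G f \<and> card (weight G f ` verts G) = c)"

definition complete_graph :: "nat \<Rightarrow> nat graph" where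
  "complete_graph n = \<lparr>verts = {..<n}, edges = {e. e \<subseteq> {..<n} \<and> card e = 2}\<rparr>"

text \<open>The vertex \<open>(i, v)\<close> is the copy of \<open>v\<close> in the \<open>i\<close>-th of the \<open>m\<close> copies of \<open>G\<close>.\<close>

definition disjoint_copies :: "nat \<Rightarrow> 'a graph \<Rightarrow> (nat \<times> 'a) graph" where
  "disjoint_copies m G =
     \<lparr>verts = {..<m} \<times> verts G, edges = {Pair i ` e | i e. i < m \<and> e \<in> edges G}\<rparr>"

lemma finite_simple_complete_graph: "finite_simple_graph (complete_graph n)"
  by (auto simp: finite_simple_graph_def complete_graph_def)

lemma finite_simple_disjoint_copies:
  assumes "finite_simple_graph G"
  shows "finite_simple_graph (disjoint_copies m G)"
proof -
  have "card (Pair i ` e) = card e" for i :: nat and e :: "'a set"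
    by (rule card_image) (auto simp: inj_on_def)
  with assms show ?thesis
    by (force simp: finite_simple_graph_def disjoint_copies_def)
qed

end

theory Submission
  imports Defs "HOL-Library.Nat_Bijection"
begin

text \<open>
  The bound holds because there is a labeling with only \<open>n\<close> weights: every vertex of \<open>K\<^sub>n\<close> has the
  same weight in all \<open>m\<close> copies. Both terms of the minimum are at least \<open>n\<close>.

  The labels of one copy form a symmetric \<open>n \<times> n\<close> matrix, with vertex labels on the diagonal and edge
  labels off it, and the weights are its row sums. In each cell \<open>{i, j}\<close> let the label be an affine
  function of the number \<open>t\<close> of the copy. The weights are then independent of \<open>t\<close> if the slopes of
  each row add up to \<open>0\<close>. Slopes \<open>1\<close> and \<open>-1\<close> are obtained by giving a cell a block of \<open>m\<close>
  consecutive labels, which the copies use in increasing or decreasing order. These two slopes do not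
  suffice, as a row has an odd number of cells; so slope \<open>2\<close> is used too, for two cells at a time that
  share a block of \<open>2 m\<close> labels, one taking the even and the other the odd places. Slope \<open>2\<close> must
  thus occur an even number of times in total and an odd number of times in each row. This is
  achieved with the diagonal cells of all but the last two vertices, and the edge between those two:
  these are \<open>n - 1 = 4 k\<close> cells (\<open>slope\<close>, \<open>sum_slope\<close>).

  The weights in one copy must differ. For this the blocks follow a ranking of the cells, with the
  edges first, in colexicographic order, and the diagonal last. Passing from row \<open>i\<close> to row \<open>i' > i\<close>
  increases the rank in each column other than \<open>i\<close> and \<open>i'\<close>; the entry of the edge \<open>{i, i'}\<close> is common to
  both rows, and the diagonal entry increases. Hence each function that increases with the rank
  has increasing row sums (\<open>row_sum_strict_mono\<close>). The centre of the progression of labels of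
  a cell is such a function, because it depends on the block but not on the direction in which the
  block is used; and as the slopes cancel, the weight is the sum of the centres. The edge of slope \<open>2\<close> is the last edge and
  the diagonal cells of slope \<open>2\<close> are the first ones on the diagonal, so the cells that share blocks
  are consecutive in the ranking (\<open>slope_eq_2_iff\<close>).
\<close>

section \<open>Labelings of copies of a complete graph as symmetric matrices\<close>

text \<open>
  Each unordered cell is represented once, with its smaller index first.
\<close>

definition cells :: "nat \<Rightarrow> (nat \<times> nat) set" where
  "cells n = {(i, j). i \<le> j \<and> j < n}"

lemma finite_cells: "finite (cells n)"
  by (rule finite_subset[of _ "{..<n} \<times> {..<n}"]) (auto simp: cells_def)

lemma card_cells: "card (cells n) = triangle n"
proof (induction n)
  case 0
  then show ?case by (simp add: cells_def)
next
  case (Suc n)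
  have "cells (Suc n) = cells n \<union> (\<lambda>i. (i, n)) ` {..n}"
    by (auto simp: cells_def less_Suc_eq)
  moreover have "card ((\<lambda>i. (i, n)) ` {..n}) = Suc n"
    by (subst card_image) (auto simp: inj_on_def)
  moreover have "cells n \<inter> (\<lambda>i. (i, n)) ` {..n} = {}"
    by (auto simp: cells_def)
  ultimately show ?case
    using Suc finite_cells[of n] by (simp add: card_Un_disjoint)
qed

lemma edges_copies_complete:
  "edges (disjoint_copies m (complete_graph n))
     = {{(t, i), (t, j)} | t i j. t < m \<and> i < j \<and> j < n}"
proof -
  have "e \<subseteq> {..<n} \<and> card e = 2 \<longleftrightarrow> (\<exists>i j. e = {i, j} \<and> i < j \<and> j < n)" for e :: "nat set"
  proof
    assume "e \<subseteq> {..<n} \<and> card e = 2"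
    then obtain x y where "e = {x, y}" "x \<noteq> y" "x < n" "y < n"
      by (auto simp: card_2_iff)
    then show "\<exists>i j. e = {i, j} \<and> i < j \<and> j < n"
      by (intro exI[of _ "min x y"] exI[of _ "max x y"]) (auto simp: min_def max_def)
  qed auto
  then have "edges (disjoint_copies m (complete_graph n))
      = {Pair t ` e | t e. t < m \<and> (\<exists>i j. e = {i, j} \<and> i < j \<and> j < n)}"
    by (simp add: disjoint_copies_def complete_graph_def)
  also have "\<dots> = {{(t, i), (t, j)} | t i j. t < m \<and> i < j \<and> j < n}"
  proof (intro equalityI subsetI)
    fix e assume "e \<in> {{(t, i), (t, j)} | t i j. t < m \<and> i < j \<and> j < n}"
    then obtain t i j where "t < m" "i < j" "j < n" "e = Pair t ` {i, j}"
      by auto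
    then show "e \<in> {Pair t ` e | t e. t < m \<and> (\<exists>i j. e = {i, j} \<and> i < j \<and> j < n)}"
      by blast
  qed auto
  finally show ?thesis .
qed

lemma incident_edges_copies_complete:
  assumes "t < m" "i < n"
  shows "{e \<in> edges (disjoint_copies m (complete_graph n)). (t, i) \<in> e}
     = (\<lambda>j. {(t, i), (t, j)}) ` ({..<n} - {i})"
proof (intro equalityI subsetI)
  fix e assume "e \<in> {e \<in> edges (disjoint_copies m (complete_graph n)). (t, i) \<in> e}"
  then show "e \<in> (\<lambda>j. {(t, i), (t, j)}) ` ({..<n} - {i})"
    by (auto simp: edges_copies_complete insert_commute)
next
  fix e assume "e \<in> (\<lambda>j. {(t, i), (t, j)}) ` ({..<n} - {i})"
  then obtain j where j: "j < n" "j \<noteq> i" "e = {(t, i), (t, j)}" by auto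
  then have "e = {(t, min i j), (t, max i j)}" "min i j < max i j" "max i j < n"
    using assms by (auto simp: min_def max_def)
  with assms j show "e \<in> {e \<in> edges (disjoint_copies m (complete_graph n)). (t, i) \<in> e}"
    unfolding edges_copies_complete by blast
qed

text \<open>
  The copy and the cell of a vertex or edge. Both endpoints of an edge have the same first component,
  so that \<open>Min\<close> merely extracts it.
\<close>

fun position :: "(nat \<times> nat) + (nat \<times> nat) set \<Rightarrow> nat \<times> nat \<times> nat" where
  "position (Inl (t, i)) = (t, i, i)"
| "position (Inr e) = (Min (fst ` e), Min (snd ` e), Max (snd ` e))"

lemma bij_betw_position:
  "bij_betw position
     (verts (disjoint_copies m (complete_graph n)) <+> edges (disjoint_copies m (complete_graph n)))
     ({..<m} \<times> cells n)"
proof -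
  have V: "verts (disjoint_copies m (complete_graph n)) = {..<m} \<times> {..<n}"
    by (simp add: disjoint_copies_def complete_graph_def)
  define cell_element where "cell_element = (\<lambda>(t :: nat, i :: nat, j :: nat).
    if i = j then Inl (t, i) else Inr {(t, i), (t, j)})"
  show ?thesis
  proof (rule bij_betw_byWitness[where f' = cell_element])
    show "\<forall>x\<in>verts (disjoint_copies m (complete_graph n)) <+> edges (disjoint_copies m (complete_graph n)).
        cell_element (position x) = x"
      by (auto simp: V edges_copies_complete cell_element_def)
    show "\<forall>c\<in>{..<m} \<times> cells n. position (cell_element c) = c"
      by (auto simp: cells_def cell_element_def)
    show "position ` (verts (disjoint_copies m (complete_graph n)) <+> edges (disjoint_copies m (complete_graph n)))
        \<subseteq> {..<m} \<times> cells n"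
      by (auto simp: V edges_copies_complete cells_def)
    show "cell_element ` ({..<m} \<times> cells n)
        \<subseteq> verts (disjoint_copies m (complete_graph n)) <+> edges (disjoint_copies m (complete_graph n))"
      by (auto simp: V edges_copies_complete cells_def cell_element_def) (metis le_neq_implies_less)
  qed
qed

text \<open>
  This reduces the graph to a family of symmetric matrices \<open>g t\<close>: it is enough that the upper triangles
  together contain each label once, as injectivity and the range imply by counting, and that the row
  sums are distinct and the same for all \<open>t\<close>.
\<close>

lemma chi_lat_copies_complete_le:
  fixes g :: "nat \<Rightarrow> nat \<Rightarrow> nat \<Rightarrow> nat"
  assumes sym: "\<And>t i j. g t i j = g t j i"
    and inj: "inj_on (\<lambda>(t, i, j). g t i j) ({..<m} \<times> cells n)"
    and range: "\<And>t i j. t < m \<Longrightarrow> (i, j) \<in> cells n \<Longrightarrow> g t i j \<in> {1..m * triangle n}"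
    and row_sum: "\<And>t i. t < m \<Longrightarrow> i < n \<Longrightarrow> (\<Sum>j<n. g t i j) = w i"
    and inj_w: "inj_on w {..<n}"
  shows "chi_lat (disjoint_copies m (complete_graph n)) \<le> n"
proof -
  let ?G = "disjoint_copies m (complete_graph n)"
  define f where "f = (\<lambda>(t, i, j). g t i j) \<circ> position"
  have V: "verts ?G = {..<m} \<times> {..<n}"
    by (simp add: disjoint_copies_def complete_graph_def)
  have finV: "finite (verts ?G)"
    by (simp add: V)
  moreover have "finite (edges ?G)"
    by (rule finite_subset[of _ "Pow (verts ?G)"])
      (auto simp: finV, auto simp: V edges_copies_complete)
  ultimately have count: "card (verts ?G) + card (edges ?G) = m * triangle n"
    using bij_betw_same_card[OF bij_betw_position[of m n]]
    by (simp add: card_Plus card_cartesian_product card_cells)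
  have "bij_betw f (verts ?G <+> edges ?G) ((\<lambda>(t, i, j). g t i j) ` ({..<m} \<times> cells n))"
    unfolding f_def by (rule bij_betw_trans[OF bij_betw_position inj_on_imp_bij_betw[OF inj]])
  moreover have "(\<lambda>(t, i, j). g t i j) ` ({..<m} \<times> cells n) = {1..m * triangle n}"
  proof (rule card_subset_eq)
    show "(\<lambda>(t, i, j). g t i j) ` ({..<m} \<times> cells n) \<subseteq> {1..m * triangle n}"
      using range by fast
    show "card ((\<lambda>(t, i, j). g t i j) ` ({..<m} \<times> cells n)) = card {1..m * triangle n}"
      using card_image[OF inj] by (simp add: card_cartesian_product card_cells)
  qed simp
  ultimately have bij: "bij_betw f (verts ?G <+> edges ?G) {1..card (verts ?G) + card (edges ?G)}"
    by (simp add: count)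
  have weight: "weight ?G f (t, i) = w i" if "t < m" "i < n" for t i
  proof -
    have "f (Inr {(t, i), (t, j)}) = g t i j" for j
      using sym[of t i j] by (cases "i \<le> j") (auto simp: f_def)
    moreover have "inj_on (\<lambda>j. {(t, i), (t, j)}) ({..<n} - {i})"
      by (auto simp: inj_on_def doubleton_eq_iff)
    ultimately have "weight ?G f (t, i) = g t i i + (\<Sum>j\<in>{..<n} - {i}. g t i j)"
      by (simp add: weight_def incident_edges_copies_complete[OF that] sum.reindex)
        (simp add: f_def)
    also have "\<dots> = (\<Sum>j<n. g t i j)"
      using that by (subst sum.remove[of "{..<n}" i]) auto
    finally show ?thesis
      using row_sum that by simp
  qed
  have "weight ?G f u \<noteq> weight ?G f v" if "{u, v} \<in> edges ?G" for u v
  proof -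
    from that obtain t i j where tij: "t < m" "i < j" "j < n" "{u, v} = {(t, i), (t, j)}"
      by (auto simp: edges_copies_complete)
    have "w i \<noteq> w j"
      using inj_on_eq_iff[OF inj_w, of i j] tij by simp
    then have "weight ?G f (t, i) \<noteq> weight ?G f (t, j)"
      using tij weight by simp
    moreover have "u = (t, i) \<and> v = (t, j) \<or> u = (t, j) \<and> v = (t, i)"
      using tij(4) by (simp add: doubleton_eq_iff)
    ultimately show ?thesis
      by metis
  qed
  with bij have "local_antimagic_total_labeling ?G f"
    by (simp add: local_antimagic_total_labeling_def)
  then have "chi_lat ?G \<le> card (weight ?G f ` verts ?G)"
    unfolding chi_lat_def by (blast intro: Least_le)
  also have "\<dots> \<le> card (w ` {..<n})"
    by (rule card_mono) (auto simp: V weight)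
  also have "\<dots> \<le> n"
    using card_image_le[of "{..<n}" w] by simp
  finally show ?thesis .
qed

section \<open>Ranking the cells of a symmetric matrix\<close>

text \<open>
  There are \<open>triangle (n - 1)\<close> edges, so the diagonal follows them directly.
\<close>

definition rank :: "nat \<Rightarrow> nat \<Rightarrow> nat \<Rightarrow> nat" where
  "rank n i j = (if i = j then triangle (n - 1) + i
     else triangle (max i j - 1) + min i j)"

lemma rank_commute: "rank n i j = rank n j i"
  by (simp add: rank_def max.commute min.commute)

lemma triangle_mono: "a \<le> b \<Longrightarrow> triangle a \<le> triangle b"
  by (induction b) (auto simp: le_Suc_eq)

lemma triangle_pred: "0 < j \<Longrightarrow> triangle j = triangle (j - 1) + j"
  by (cases j) auto

lemma rank_edge_less:
  assumes "i < j" "j < n"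
  shows "rank n i j < triangle (n - 1)"
proof -
  have "triangle j \<le> triangle (n - 1)"
    using assms by (intro triangle_mono) linarith
  then show ?thesis
    using assms triangle_pred[of j] by (simp add: rank_def)
qed

lemma rank_less:
  assumes "(i, j) \<in> cells n"
  shows "rank n i j < triangle n"
proof -
  have "triangle n = triangle (n - 1) + n"
    using assms by (intro triangle_pred) (auto simp: cells_def)
  moreover have "rank n i j < triangle (n - 1) + n"
    using assms rank_edge_less[of i j n] by (cases "i = j") (auto simp: cells_def rank_def)
  ultimately show ?thesis by simp
qed

text \<open>
  On edges the ranking is the Cantor pairing function, applied to the smaller endpoint and the number
  of vertices strictly between the endpoints.
\<close>

lemma inj_on_rank: "inj_on (\<lambda>(i, j). rank n i j) (cells n)"
proof (rule inj_onI, clarify)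
  fix i j i' j' assume c: "(i, j) \<in> cells n" "(i', j') \<in> cells n" "rank n i j = rank n i' j'"
  have edge: "rank n a b = prod_encode (a, b - 1 - a)" if "a < b" for a b
    using that by (simp add: rank_def prod_encode_def)
  have "i = j \<longleftrightarrow> i' = j'"
    using c rank_edge_less[of i j n] rank_edge_less[of i' j' n]
    by (auto simp: cells_def rank_def split: if_splits)
  moreover have "i = i' \<and> j = j'" if "i < j" "i' < j'"
    using c edge[OF that(1)] edge[OF that(2)] that by simp linarith
  ultimately show "i = i' \<and> j = j'"
    using c by (cases "i = j") (auto simp: cells_def rank_def)
qed

lemma rank_strict_mono:
  assumes "i < i'" "j \<noteq> i" "j \<noteq> i'"
  shows "rank n i j < rank n i' j"
proof -
  consider "j < i" | "i < j" "j < i'" | "i' < j"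
    using assms by linarith
  then show ?thesis
  proof cases
    case 1
    have "triangle i \<le> triangle (i' - 1)"
      using assms by (intro triangle_mono) linarith
    then show ?thesis
      using 1 assms triangle_pred[of i] by (simp add: rank_def)
  next
    case 2
    have "triangle j \<le> triangle (i' - 1)"
      using 2 by (intro triangle_mono) linarith
    then show ?thesis
      using 2 triangle_pred[of j] by (simp add: rank_def)
  next
    case 3
    then show ?thesis
      using assms by (simp add: rank_def)
  qed
qed

lemma row_sum_strict_mono:
  fixes A :: "nat \<Rightarrow> int"
  assumes "strict_mono A" "i < i'" "i' < n"
  shows "(\<Sum>j<n. A (rank n i j)) < (\<Sum>j<n. A (rank n i' j))"
proof -
  let ?J = "{..<n} - {i, i'}"
  have split: "(\<Sum>j<n. h j) = h i + h i' + (\<Sum>j\<in>?J. h j)" for h :: "nat \<Rightarrow> int"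
    using assms sum.subset_diff[of "{i, i'}" "{..<n}" h] by simp
  have "A (rank n i i) < A (rank n i' i')"
    using assms by (auto intro!: strict_monoD[of A] simp: rank_def)
  moreover have "(\<Sum>j\<in>?J. A (rank n i j)) \<le> (\<Sum>j\<in>?J. A (rank n i' j))"
    using assms(2)
    by (intro sum_mono less_imp_le strict_monoD[OF assms(1)] rank_strict_mono) auto
  ultimately show ?thesis
    unfolding split rank_commute[of n i' i] by linarith
qed

section \<open>Slopes with vanishing row sums\<close>

text \<open>
  The vertices below \<open>4 k\<close> are split into two halves of size \<open>2 k\<close>. If the edges inside the halves are
  positive and those between them negative, each of these vertices has \<open>2 k - 1\<close> positive and
  \<open>2 k\<close> negative edges, apart from its edge to the vertex \<open>4 k\<close>. That vertex needs \<open>2 k - 2\<close> positive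
  edges. To provide them without changing the number at any other vertex, a perfect matching
  on the first \<open>2 k - 2\<close> vertices, \<open>i\<close> with \<open>2 k - 3 - i\<close>, is made negative, and the edges from \<open>4 k\<close> to the
  matched vertices positive.
\<close>

definition plus_edge :: "nat \<Rightarrow> nat \<Rightarrow> nat \<Rightarrow> bool" where
  "plus_edge k i j \<longleftrightarrow> i < 2 * k \<and> j < 2 * k \<and> i + j + 3 \<noteq> 2 * k
     \<or> 2 * k \<le> i \<and> i < 4 * k \<and> 2 * k \<le> j \<and> j < 4 * k
     \<or> j = 4 * k \<and> i + 2 < 2 * k \<or> i = 4 * k \<and> j + 2 < 2 * k"

text \<open>
  The diagonal entries of the last two vertices, \<open>4 k - 1\<close> and \<open>4 k\<close>, must have opposite signs. Indeed,
  if all row sums vanish, so does the trace plus twice the sum of the slopes of all edges. Since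
  \<open>8 k\<^sup>2 + 2 k - 1\<close> edges, an odd number, have odd slope, the trace is \<open>2\<close> modulo \<open>4\<close>; and the first
  \<open>4 k - 1\<close> diagonal entries already contribute \<open>2\<close> modulo \<open>4\<close>.
  Distinct \<open>i\<close> and \<open>j\<close> up to \<open>4 k\<close> satisfy \<open>i + j + 1 = 8 k\<close> only as the edge between these two.
\<close>

definition slope :: "nat \<Rightarrow> nat \<Rightarrow> nat \<Rightarrow> int" where
  "slope k i j =
    (if i = j then (if i + 1 < 4 * k then 2 else if i + 1 = 4 * k then -1 else 1)
     else if i + j + 1 = 8 * k then 2
     else if plus_edge k i j then 1 else -1)"

lemma slope_commute: "slope k i j = slope k j i"
  by (auto simp: slope_def plus_edge_def)

text \<open>
  In each row the slopes are constant on either half except in at most two columns: the diagonal, the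
  matched vertex, the last vertex of the upper half, or the two unmatched vertices of the lower half.
\<close>

lemma sum_slope:
  assumes "1 \<le> k" "i < 4 * k + 1"
  shows "(\<Sum>j<4 * k + 1. slope k i j) = 0"
proof -
  let ?lo = "{..<2 * k}" and ?hi = "{2 * k..<4 * k}"
  have "{..<4 * k + 1} = insert (4 * k) (?lo \<union> ?hi)"
    by auto
  then have split: "(\<Sum>j<4 * k + 1. slope k i j)
      = slope k i (4 * k) + (\<Sum>j\<in>?lo. slope k i j) + (\<Sum>j\<in>?hi. slope k i j)"
    by (simp add: sum.union_disjoint ivl_disj_int)
  consider "i + 2 < 2 * k" | "i < 2 * k" "2 * k \<le> i + 2" | "2 * k \<le> i" "i + 1 < 4 * k"
    | "i + 1 = 4 * k" | "i = 4 * k"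
    using assms by linarith
  then show ?thesis
  proof cases
    case 1
    \<comment> \<open>The two exceptional columns \<open>i\<close> and \<open>2 k - 3 - i\<close> differ, as their sum is odd.\<close>
    have "(\<Sum>j\<in>?lo. slope k i j)
        = (\<Sum>j\<in>?lo. 1 + (if j = i then 1 else 0) + (if j = 2 * k - 3 - i then -2 else 0))"
      using 1 by (intro sum.cong) (auto simp: slope_def plus_edge_def, presburger+)
    also have "\<dots> = 2 * int k - 1"
      using 1 by (simp add: sum.distrib)
    finally have "(\<Sum>j\<in>?lo. slope k i j) = 2 * int k - 1" .
    moreover have "(\<Sum>j\<in>?hi. slope k i j) = (\<Sum>j\<in>?hi. -1)"
      using 1 by (intro sum.cong) (auto simp: slope_def plus_edge_def)
    moreover have "slope k i (4 * k) = 1"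
      using 1 by (simp add: slope_def plus_edge_def)
    ultimately show ?thesis
      unfolding split by simp
  next
    case 2
    have "(\<Sum>j\<in>?lo. slope k i j) = (\<Sum>j\<in>?lo. 1 + (if j = i then 1 else 0))"
      using 2 by (intro sum.cong) (auto simp: slope_def plus_edge_def)
    also have "\<dots> = 2 * int k + 1"
      using 2 by (simp add: sum.distrib)
    finally have "(\<Sum>j\<in>?lo. slope k i j) = 2 * int k + 1" .
    moreover have "(\<Sum>j\<in>?hi. slope k i j) = (\<Sum>j\<in>?hi. -1)"
      using 2 by (intro sum.cong) (auto simp: slope_def plus_edge_def)
    moreover have "slope k i (4 * k) = -1"
      using 2 by (simp add: slope_def plus_edge_def)
    ultimately show ?thesis
      unfolding split by simp
  next
    case 3
    have "(\<Sum>j\<in>?lo. slope k i j) = (\<Sum>j\<in>?lo. -1)"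
      using 3 by (intro sum.cong) (auto simp: slope_def plus_edge_def)
    moreover have "(\<Sum>j\<in>?hi. slope k i j) = (\<Sum>j\<in>?hi. 1 + (if j = i then 1 else 0))"
      using 3 by (intro sum.cong) (auto simp: slope_def plus_edge_def)
    moreover have "\<dots> = 2 * int k + 1"
      using 3 by (simp add: sum.distrib)
    moreover have "slope k i (4 * k) = -1"
      using 3 by (simp add: slope_def plus_edge_def)
    ultimately show ?thesis
      unfolding split by simp
  next
    case 4
    have "(\<Sum>j\<in>?lo. slope k i j) = (\<Sum>j\<in>?lo. -1)"
      using 4 by (intro sum.cong) (auto simp: slope_def plus_edge_def)
    moreover have "(\<Sum>j\<in>?hi. slope k i j) = (\<Sum>j\<in>?hi. 1 + (if j = i then -2 else 0))"
      using 4 by (intro sum.cong) (auto simp: slope_def plus_edge_def)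
    moreover have "\<dots> = 2 * int k - 2"
      using 4 assms by (simp add: sum.distrib)
    moreover have "slope k i (4 * k) = 2"
      using 4 by (simp add: slope_def plus_edge_def)
    ultimately show ?thesis
      unfolding split by simp
  next
    case 5
    have "?lo = {..<2 * k - 2} \<union> {2 * k - 2..<2 * k}"
      by auto
    then have "(\<Sum>j\<in>?lo. slope k i j)
        = (\<Sum>j\<in>{..<2 * k - 2}. slope k i j) + (\<Sum>j\<in>{2 * k - 2..<2 * k}. slope k i j)"
      by (simp add: sum.union_disjoint ivl_disj_int)
    moreover have "(\<Sum>j\<in>{..<2 * k - 2}. slope k i j) = (\<Sum>j\<in>{..<2 * k - 2}. 1)"
      using 5 assms by (intro sum.cong) (auto simp: slope_def plus_edge_def)
    moreover have "(\<Sum>j\<in>{2 * k - 2..<2 * k}. slope k i j) = (\<Sum>j\<in>{2 * k - 2..<2 * k}. -1)"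
      using 5 assms by (intro sum.cong) (auto simp: slope_def plus_edge_def)
    moreover have "(\<Sum>j\<in>?hi. slope k i j) = (\<Sum>j\<in>?hi. -1 + (if j = 4 * k - 1 then 3 else 0))"
      using 5 by (intro sum.cong) (auto simp: slope_def plus_edge_def)
    moreover have "\<dots> = - 2 * int k + 3"
      using assms by (simp add: sum_subtractf)
    moreover have "slope k i (4 * k) = 1"
      using 5 by (simp add: slope_def plus_edge_def)
    ultimately show ?thesis
      unfolding split using assms by (simp add: of_nat_diff)
  qed
qed

lemma slope_eq_2_iff:
  assumes "1 \<le> k" "(i, j) \<in> cells (4 * k + 1)"
  shows "slope k i j = 2 \<longleftrightarrow>
    triangle (4 * k) - 1 \<le> rank (4 * k + 1) i j \<and> rank (4 * k + 1) i j < triangle (4 * k) - 1 + 4 * k"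
proof -
  have pos: "triangle (4 * k) = triangle (4 * k - 1) + 4 * k"
    using assms by (intro triangle_pred) auto
  consider "i = j" | "i < j" "j < 4 * k" | "i < j" "j = 4 * k"
    using assms by (force simp: cells_def)
  then show ?thesis
  proof cases
    case 1
    then show ?thesis
      using assms pos by (auto simp: slope_def rank_def cells_def)
  next
    case 2
    then have "rank (4 * k + 1) i j = rank (4 * k) i j"
      by (simp add: rank_def)
    then show ?thesis
      using 2 pos rank_edge_less[of i j "4 * k"] by (auto simp: slope_def)
  next
    case 3
    then show ?thesis
      using pos assms by (auto simp: slope_def rank_def)
  qed
qed

section \<open>Labels with prescribed slopes\<close>

text \<open>
  Cells of slope \<open>2\<close> occupy the ranks from \<open>h\<close> to \<open>h + 2 l - 1\<close> and are paired by \<open>(r - h) div 2\<close>; both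
  cells of a pair start at the block of the first one.
\<close>

definition block :: "nat \<Rightarrow> int \<Rightarrow> nat \<Rightarrow> nat" where
  "block h s r = (if s = 2 then h + 2 * ((r - h) div 2) else r)"

definition offset :: "nat \<Rightarrow> nat \<Rightarrow> int \<Rightarrow> nat \<Rightarrow> nat \<Rightarrow> nat" where
  "offset m h s r t =
    (if s = 2 then 2 * t + (r - h) mod 2 else if s = 1 then t else m - 1 - t)"

definition label :: "nat \<Rightarrow> nat \<Rightarrow> int \<Rightarrow> nat \<Rightarrow> nat \<Rightarrow> nat" where
  "label m h s r t = Suc (m * block h s r + offset m h s r t)"

text \<open>
  Twice the mean of the labels that a cell receives in the \<open>m\<close> copies. Doubling avoids fractions, since the
  mean of a block of even length is not an integer.
\<close>

definition double_centre :: "nat \<Rightarrow> nat \<Rightarrow> nat \<Rightarrow> nat \<Rightarrow> int" where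
  "double_centre m h l r =
    (if h \<le> r \<and> r < h + 2 * l
     then 2 * int (m * (h + 2 * ((r - h) div 2))) + 2 * int ((r - h) mod 2) + 2 * int m
     else 2 * int (m * r) + int m + 1)"

lemma double_label:
  assumes "t < m" "s \<in> {-1, 1, 2}" "s = 2 \<longleftrightarrow> h \<le> r \<and> r < h + 2 * l"
  shows "2 * int (label m h s r t) = double_centre m h l r + s * (2 * int t - (int m - 1))"
  using assms by (auto simp: label_def block_def offset_def double_centre_def of_nat_diff algebra_simps)

text \<open>
  Within a pair of cells of slope \<open>2\<close> the centres differ by \<open>1\<close> only; between other neighbouring ranks they
  differ by at least \<open>m\<close>.
\<close>

lemma strict_mono_double_centre:
  assumes "1 \<le> m"
  shows "strict_mono (double_centre m h l)"
  unfolding strict_mono_Suc_iff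
proof
  fix r
  consider "Suc r < h \<or> h + 2 * l \<le> r" | "Suc r = h" "l = 0" | "Suc r = h" "l \<noteq> 0"
    | "h \<le> r" "r < h + 2 * l"
    by linarith
  then show "double_centre m h l r < double_centre m h l (Suc r)"
  proof cases
    case 4
    define q where "q = (r - h) div 2"
    from 4 have "q < l" "r = h + 2 * q \<or> r = Suc (h + 2 * q)"
      unfolding q_def by linarith+
    then consider "r = h + 2 * q" "q < l" | "r = Suc (h + 2 * q)" "q < l"
      by auto
    then show ?thesis
    proof cases
      case 1
      then show ?thesis
        using assms by (simp add: double_centre_def)
    next
      case 2
      then have "Suc r - h = 2 * (q + 1)" "r - h = Suc (2 * q)" "Suc r < h + 2 * l \<longleftrightarrow> q + 1 < l"
        by auto
      moreover have "Suc (2 * q) mod 2 = 1"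
        by presburger
      ultimately show ?thesis
        using 2 assms by (simp add: double_centre_def distrib_left distrib_right)
    qed
  qed (use assms in \<open>auto simp: double_centre_def algebra_simps\<close>)
qed

lemma offset_less:
  assumes "t < m"
  shows "offset m h s r t < m * (if s = 2 then 2 else 1)"
proof (cases "s = 2")
  case True
  have "(r - h) mod 2 < 2" by simp
  with True assms show ?thesis
    unfolding offset_def by simp
qed (use assms in \<open>simp add: offset_def\<close>)

lemma block_bounds:
  assumes "h \<le> r" "r < h + 2 * l" "s = 2"
  shows "h \<le> block h s r" "block h s r + 2 \<le> h + 2 * l"
proof -
  have "(r - h) div 2 < l"
    using assms by simp
  with assms show "h \<le> block h s r" "block h s r + 2 \<le> h + 2 * l"
    by (simp_all add: block_def)
qed

lemma block_offset_unique:
  fixes b c u :: nat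
  assumes "m * b + u = m * b' + u'" "u < m * c"
  shows "\<not> b + c \<le> b'"
proof
  assume "b + c \<le> b'"
  then have "m * (b + c) \<le> m * b'"
    by (rule mult_le_mono2)
  with assms show False
    by (simp add: distrib_left)
qed

text \<open>
  Cells that do not share a block have disjoint ranges of labels; cells that do share one are told apart
  by the parity of the offset.
\<close>

lemma label_inj:
  assumes t: "t < m" "t' < m"
    and s: "s = 2 \<longleftrightarrow> h \<le> r \<and> r < h + 2 * l" "s' = 2 \<longleftrightarrow> h \<le> r' \<and> r' < h + 2 * l"
    and eq: "label m h s r t = label m h s' r' t'"
    and same: "r = r' \<Longrightarrow> s = s'"
  shows "r = r' \<and> t = t'"
proof -
  let ?b = "block h s r" and ?u = "offset m h s r t"
  let ?b' = "block h s' r'" and ?u' = "offset m h s' r' t'"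
  have sum: "m * ?b + ?u = m * ?b' + ?u'"
    using eq by (simp add: label_def)
  note u = offset_less[OF t(1), of h s r] and u' = offset_less[OF t(2), of h s' r']
  note sep = block_offset_unique[OF sum u] block_offset_unique[OF sum[symmetric] u']
  show ?thesis
  proof (cases "s = 2 \<and> s' = 2")
    case True
    with sep have q: "(r - h) div 2 = (r' - h) div 2"
      unfolding block_def by simp
    then have o: "2 * t + (r - h) mod 2 = 2 * t' + (r' - h) mod 2"
      using sum True by (simp add: block_def offset_def)
    have "(2 * x + y mod 2) mod 2 = y mod 2" for x y :: nat
      by simp
    with o have e: "(r - h) mod 2 = (r' - h) mod 2"
      by metis
    have "r - h = r' - h"
      using q e by (metis div_mult_mod_eq)
    with True s e o show ?thesis by linarith
  next
    case False
    have b: "s = 2 \<longrightarrow> h \<le> ?b \<and> ?b + 2 \<le> h + 2 * l" "s' = 2 \<longrightarrow> h \<le> ?b' \<and> ?b' + 2 \<le> h + 2 * l"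
      using s block_bounds by blast+
    have b': "s \<noteq> 2 \<longrightarrow> ?b = r" "s' \<noteq> 2 \<longrightarrow> ?b' = r'"
      by (simp_all add: block_def)
    have "s \<noteq> 2 \<and> s' \<noteq> 2"
    proof (rule ccontr)
      assume "\<not> (s \<noteq> 2 \<and> s' \<noteq> 2)"
      with False consider "s = 2" "s' \<noteq> 2" | "s \<noteq> 2" "s' = 2" by blast
      then show False
      proof cases
        case 1
        with s have "r' < h \<or> h + 2 * l \<le> r'" by auto
        with 1 b b' sep show False by auto
      next
        case 2
        with s have "r < h \<or> h + 2 * l \<le> r" by auto
        with 2 b b' sep show False by auto
      qed
    qed
    moreover from this have "r = r'"
      using sep b' by simp
    moreover from this have "?u = ?u'"
      using sum same by simp
    ultimately show ?thesis
      using same t by (auto simp: offset_def split: if_splits)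
  qed
qed

lemma label_le:
  assumes "t < m" "s = 2 \<longleftrightarrow> h \<le> r \<and> r < h + 2 * l" "r < N" "h + 2 * l \<le> N"
  shows "label m h s r t \<le> m * N"
proof -
  let ?c = "if s = 2 then 2 else 1 :: nat"
  have "block h s r + ?c \<le> N"
  proof (cases "s = 2")
    case True
    with assms block_bounds[of h r l s] show ?thesis by simp
  next
    case False
    with assms show ?thesis by (simp add: block_def)
  qed
  then have "m * (block h s r + ?c) \<le> m * N"
    by (rule mult_le_mono2)
  then show ?thesis
    unfolding label_def using offset_less[OF assms(1), of h s r] by (simp only: distrib_left)
qed

text \<open>
  The slope-\<open>2\<close> cells begin with the last edge, whence \<open>h\<close> is one less than the number of edges, and there
  are \<open>2 k\<close> pairs of them.
\<close>

lemma chi_lat_copies_complete: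
  assumes "1 \<le> m" "1 \<le> k"
  shows "chi_lat (disjoint_copies m (complete_graph (4 * k + 1))) \<le> 4 * k + 1"
proof -
  define n where "n = 4 * k + 1"
  define h where "h = triangle (4 * k) - 1"
  define g where "g = (\<lambda>t i j. label m h (slope k i j) (rank n i j) t)"
  define A where "A = double_centre m h (2 * k)"
  have slope_range: "slope k i j \<in> {-1, 1, 2}" for i j
    by (simp add: slope_def)
  have slope_2: "slope k i j = 2 \<longleftrightarrow> h \<le> rank n i j \<and> rank n i j < h + 2 * (2 * k)"
    if "(i, j) \<in> cells n" for i j
    using slope_eq_2_iff[OF assms(2)] that by (simp add: n_def h_def)
  have g_sym: "g t i j = g t j i" for t i j
    by (simp add: g_def slope_commute[of k i j] rank_commute[of n i j])
  have double_g: "2 * int (g t i j) = A (rank n i j) + slope k i j * (2 * int t - (int m - 1))"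
    if "t < m" "i < n" "j < n" for t i j
  proof -
    have "2 * int (g t i j) = A (rank n i j) + slope k i j * (2 * int t - (int m - 1))"
      if "(i, j) \<in> cells n" for i j
      unfolding g_def A_def using \<open>t < m\<close> slope_range slope_2[OF that] by (rule double_label)
    from this[of i j] this[of j i] that show ?thesis
      by (cases "i \<le> j")
        (auto simp: cells_def g_sym[of t j i] slope_commute[of k j i] rank_commute[of n j i])
  qed
  define w where "w = (\<lambda>i. \<Sum>j<n. g 0 i j)"
  have double_sum: "2 * int (\<Sum>j<n. g t i j) = (\<Sum>j<n. A (rank n i j))" if "t < m" "i < n" for t i
  proof -
    have "2 * int (\<Sum>j<n. g t i j)
        = (\<Sum>j<n. A (rank n i j) + slope k i j * (2 * int t - (int m - 1)))"
      using that by (simp add: sum_distrib_left double_g)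
    also have "\<dots> = (\<Sum>j<n. A (rank n i j)) + (\<Sum>j<n. slope k i j) * (2 * int t - (int m - 1))"
      by (simp add: sum.distrib sum_distrib_right)
    finally show ?thesis
      using sum_slope[OF assms(2), of i] that by (simp add: n_def)
  qed
  have "chi_lat (disjoint_copies m (complete_graph n)) \<le> n"
  proof (rule chi_lat_copies_complete_le[where g = g and w = w])
    show "g t i j = g t j i" for t i j
      by (rule g_sym)
    have "t = t' \<and> i = i' \<and> j = j'"
      if t: "t < m" "t' < m" and c: "(i, j) \<in> cells n" "(i', j') \<in> cells n"
        and eq: "g t i j = g t' i' j'" for t i j t' i' j'
    proof -
      have cell: "i = i' \<and> j = j'" if "rank n i j = rank n i' j'"
        using that c inj_onD[OF inj_on_rank[of n], of "(i, j)" "(i', j')"] by auto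
      have "rank n i j = rank n i' j' \<and> t = t'"
        using t slope_2[OF c(1)] slope_2[OF c(2)] eq[unfolded g_def]
        by (rule label_inj) (use cell in blast)
      with cell show ?thesis
        by blast
    qed
    then show "inj_on (\<lambda>(t, i, j). g t i j) ({..<m} \<times> cells n)"
      unfolding inj_on_def by fast
    show "g t i j \<in> {1..m * triangle n}" if "t < m" "(i, j) \<in> cells n" for t i j
    proof -
      have "h + 2 * (2 * k) \<le> triangle n"
        by (simp add: h_def n_def)
      then have "g t i j \<le> m * triangle n"
        unfolding g_def using that slope_2 rank_less
        by (intro label_le[where l = "2 * k"]) auto
      then show ?thesis
        by (simp add: g_def label_def)
    qed
    show "(\<Sum>j<n. g t i j) = w i" if "t < m" "i < n" for t i
      using double_sum[OF that] double_sum[OF _ that(2), of 0] assms(1) unfolding w_def by linarith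
    have "w i < w i'" if "i < i'" "i' < n" for i i'
    proof -
      have "(\<Sum>j<n. A (rank n i j)) < (\<Sum>j<n. A (rank n i' j))"
        unfolding A_def using strict_mono_double_centre[OF assms(1)] that by (rule row_sum_strict_mono)
      with double_sum[of 0 i] double_sum[of 0 i'] that assms(1) show ?thesis
        unfolding w_def by linarith
    qed
    then show "inj_on w {..<n}"
      by (intro linorder_inj_onI) (auto simp: less_imp_neq)
  qed
  then show ?thesis
    by (simp add: n_def)
qed

theorem theorem2p9:
  fixes m n k :: nat
  assumes "m \<ge> 2" and "n = 4 * k + 1" and "n \<ge> 5"
  shows "chi_lat (disjoint_copies m (complete_graph n)) \<le> min (n + 3) (n - 1 + m)"
proof -
  have "chi_lat (disjoint_copies m (complete_graph n)) \<le> n"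
    using chi_lat_copies_complete[of m k] assms by simp
  with assms(1) show ?thesis
    by simp
qed

end
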